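(* Let $\mathcal{B}$ be a boolean $\mathcal{C}$-algebra. Then $\mathcal{B}$ is $\mathrm{q}_\omega$-compact if and only if there exists neither an $E_0$-system nor an $E_1$-system over $\mathcal{B}$.
   Context: Language. Let $\mathcal{L}=\{\vee,\cdot,\bar{\ },0,1\}\cup\{\mathbf{c}_i\mid i\in I\}$ be the language of boolean algebras (disjunction, conjunction, negation, $0$, $1$) extended by an arbitrary (possibly infinite) set of constant symbols. A boolean $\mathcal{C}$-algebra is a boolean algebra $\mathcal{B}$ regarded as a structure of the language $\mathcal{L}$, where $\mathcal{C}\subseteq\mathcal{B}$ denotes the boolean subalgebra generated by (the interpretations of) the constants $\mathbf{c}_i$, $i\in I$. Equations. For a finite set of variables $X=\{x_1,\dots,x_n\}$, an equation over $\mathcal{B}$ is an atomic formula $\tau(X)=\sigma(X)$, where $\tau,\sigma$ are $\mathcal{L}$-terms in $X$. A system is an arbitrary (possibly infinite) set of equations in a common finite set of variables. $V_{\mathcal{B}}(\mathcal{S})\subseteq\mathcal{B}^n$ denotes the solution set of $\mathcal{S}$ in $\mathcal{B}$ (and $V_{\mathcal{B}}(\tau(X)=\sigma(X))$ that of a single equation). $\mathrm{q}_\omega$-compactness. $\mathcal{B}$ is $\mathrm{q}_\omega$-compact if for any system $\mathcal{S}$ and any equation $\tau(X)=\sigma(X)$ with $V_{\mathcal{B}}(\mathcal{S})\subseteq V_{\mathcal{B}}(\tau(X)=\sigma(X))$ there exists a finite subsystem $\mathcal{S}'\subseteq\mathcal{S}$ with $V_{\mathcal{B}}(\mathcal{S}')\subseteq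 V_{\mathcal{B}}(\tau(X)=\sigma(X))$. $E_k$-systems. For $k\in\mathbb{N}=\{0,1,2,\dots\}$, a system $\mathcal{S}$ over $\mathcal{B}$ is an $E_k$-system if $|V_{\mathcal{B}}(\mathcal{S})|=k$ but $V_{\mathcal{B}}(\mathcal{S}')$ is infinite for every finite subsystem $\mathcal{S}'\subseteq\mathcal{S}$. *)

theory Defs
  imports Main "HOL-Library.FuncSet"
begin

text \<open>
  A boolean \<open>\<C>\<close>-algebra is given by a type of class \<open>boolean_algebra\<close>, a set \<open>I\<close> indexing
  the constant symbols (possibly empty or infinite) and their interpretation
  \<open>c :: 'i \<Rightarrow> 'b\<close>; values of \<open>c\<close> outside \<open>I\<close> play no role. The subalgebra \<open>\<C>\<close> is
  determined by these data. The class also admits the one-element algebra.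
\<close>

datatype (consts_of: 'i, vars_of: 'v) bterm =
    Zero
  | One
  | Const 'i
  | Var 'v
  | Neg "('i, 'v) bterm"
  | Or "('i, 'v) bterm" "('i, 'v) bterm"
  | And "('i, 'v) bterm" "('i, 'v) bterm"

primrec eval :: "('i \<Rightarrow> 'b::boolean_algebra) \<Rightarrow> ('v \<Rightarrow> 'b) \<Rightarrow> ('i, 'v) bterm \<Rightarrow> 'b" where
  "eval c p Zero = bot"
| "eval c p One = top"
| "eval c p (Const i) = c i"
| "eval c p (Var x) = p x"
| "eval c p (Neg t) = - eval c p t"
| "eval c p (Or t s) = sup (eval c p t) (eval c p s)"
| "eval c p (And t s) = inf (eval c p t) (eval c p s)"

text \<open>
  The variables are \<open>x\<^sub>0, \<dots>, x\<^sub>n\<^sub>-\<^sub>1\<close>, represented by their indices. The pair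
  \<open>(\<tau>, \<sigma>)\<close> stands for the equation \<open>\<tau> = \<sigma>\<close>.
\<close>

definition terms :: "'i set \<Rightarrow> nat \<Rightarrow> ('i, nat) bterm set" where
  "terms I n = {t. consts_of t \<subseteq> I \<and> vars_of t \<subseteq> {..<n}}"

type_synonym 'i equation = "('i, nat) bterm \<times> ('i, nat) bterm"

definition equations :: "'i set \<Rightarrow> nat \<Rightarrow> 'i equation set" where
  "equations I n = terms I n \<times> terms I n"

text \<open>
  Points of \<open>\<B>\<^sup>n\<close> are extensional functions on \<open>{..<n}\<close>, so that each point has
  exactly one representation and cardinalities of solution sets are correct.
\<close>

definition solutions ::
    "('i \<Rightarrow> 'b::boolean_algebra) \<Rightarrow> nat \<Rightarrow> 'i equation set \<Rightarrow> (nat \<Rightarrow> 'b) set" where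
  "solutions c n S =
     {p \<in> {..<n} \<rightarrow>\<^sub>E UNIV. \<forall>(\<tau>, \<sigma>) \<in> S. eval c p \<tau> = eval c p \<sigma>}"

definition q_omega_compact :: "'i set \<Rightarrow> ('i \<Rightarrow> 'b::boolean_algebra) \<Rightarrow> bool" where
  "q_omega_compact I c \<longleftrightarrow>
     (\<forall>n. \<forall>S \<subseteq> equations I n. \<forall>e \<in> equations I n.
        solutions c n S \<subseteq> solutions c n {e} \<longrightarrow>
        (\<exists>S' \<subseteq> S. finite S' \<and> solutions c n S' \<subseteq> solutions c n {e}))"

text \<open>
  Finiteness of the solution set is stated explicitly because \<open>card\<close> is \<open>0\<close> on
  infinite sets.
\<close>

definition E_system ::
    "'i set \<Rightarrow> ('i \<Rightarrow> 'b::boolean_algebra) \<Rightarrow> nat \<Rightarrow> nat \<Rightarrow> 'i equation set \<Rightarrow> bool" where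
  "E_system I c k n S \<longleftrightarrow>
     S \<subseteq> equations I n \<and>
     finite (solutions c n S) \<and> card (solutions c n S) = k \<and>
     (\<forall>S' \<subseteq> S. finite S' \<longrightarrow> infinite (solutions c n S'))"

end

theory Submission imports Defs
begin

text \<open>
  If \<open>\<B>\<close> is \<open>q\<^sub>\<omega>\<close>-compact and \<open>S(x)\<close> has at most one solution, then \<open>S(x) \<union> S(y)\<close> entails
  every equation \<open>x\<^sub>i = y\<^sub>i\<close>; compactness gives a finite subsystem of \<open>S\<close> with at most one
  solution, so \<open>S\<close> is neither an \<open>E\<^sub>0\<close>- nor an \<open>E\<^sub>1\<close>-system.

  Conversely, let \<open>S\<close> entail \<open>\<tau> = \<sigma>\<close> while no finite subsystem does. If \<open>S\<close> is
  inconsistent, it is an \<open>E\<^sub>0\<close>-system. Otherwise relativize \<open>S\<close> to a new variable \<open>z\<close>, adding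
  \<open>z \<le> \<tau> \<triangle> \<sigma>\<close> and \<open>x\<^sub>i \<le> z\<close>. A solution of the new system, glued below \<open>z\<close> with a solution of
  \<open>S\<close> below \<open>- z\<close>, solves \<open>S\<close>, which forces \<open>z = 0\<close>; so the origin is the only solution. A
  finite subsystem has further solutions, with \<open>z = \<tau> \<triangle> \<sigma>\<close> at a point violating \<open>\<tau> = \<sigma>\<close>. In
  both cases no finite subsystem is equivalent to the whole system, whose solution set is finite,
  and this already implies that all finite subsystems have infinitely many solutions.
\<close>

section \<open>Evaluation of terms and finite subsystems\<close>

lemma eval_map_bterm: "eval c p (map_bterm id f t) = eval c (\<lambda>x. p (f x)) t"
  by (induction t) auto

lemma inf_uminus_cong:
  fixes a b w :: "'b::boolean_algebra"
  assumes "inf w a = inf w b"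
  shows "inf w (- a) = inf w (- b)"
proof -
  have "inf w (- a) = inf w (- inf w a)" for a
    by (simp add: inf_sup_distrib1)
  then show ?thesis using assms by metis
qed

text \<open>Meeting with \<open>w\<close> is a homomorphism onto the boolean algebra of elements
  below \<open>w\<close>, where complements are taken relative to \<open>w\<close>. This drives both
  the gluing and the cutting down of solutions.\<close>

lemma inf_eval_cong:
  assumes "\<And>x. x \<in> vars_of t \<Longrightarrow> inf w (p x) = inf w (q x)"
  shows "inf w (eval c p t) = inf w (eval c q t)"
  using assms
proof (induction t)
  case (Neg t)
  then show ?case by (auto intro: inf_uminus_cong)
next
  case (Or t s)
  then show ?case by (simp add: inf_sup_distrib1)
next
  case (And t s)
  have "inf w (inf a b) = inf (inf w a) (inf w b)" for a b
    by (simp add: ac_simps)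
  with And show ?case by simp
qed auto

lemma eval_cong:
  assumes "\<And>x. x \<in> vars_of t \<Longrightarrow> p x = q x"
  shows "eval c p t = eval c q t"
  using inf_eval_cong[of t top p q c] assms by simp

lemma terms_varsD: "t \<in> terms I n \<Longrightarrow> x \<in> vars_of t \<Longrightarrow> x < n"
  by (auto simp: terms_def)

lemma solutions_antimono: "S \<subseteq> T \<Longrightarrow> solutions c n T \<subseteq> solutions c n S"
  by (auto simp: solutions_def)

lemma solutions_iff:
  "p \<in> solutions c n S \<longleftrightarrow>
     p \<in> {..<n} \<rightarrow>\<^sub>E UNIV \<and> (\<forall>\<tau> \<sigma>. (\<tau>, \<sigma>) \<in> S \<longrightarrow> eval c p \<tau> = eval c p \<sigma>)"
  by (auto simp: solutions_def)

lemma solutionsI: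
  assumes "p \<in> {..<n} \<rightarrow>\<^sub>E UNIV" "\<And>\<tau> \<sigma>. (\<tau>, \<sigma>) \<in> S \<Longrightarrow> eval c p \<tau> = eval c p \<sigma>"
  shows "p \<in> solutions c n S"
  using assms by (simp add: solutions_iff)

lemma solutionsD:
  "p \<in> solutions c n S \<Longrightarrow> (\<tau>, \<sigma>) \<in> S \<Longrightarrow> eval c p \<tau> = eval c p \<sigma>"
  by (simp add: solutions_iff)

lemma solutions_finite_subsystem:
  assumes "S0 \<subseteq> S" "finite S0" "finite (solutions c n S0)"
  obtains S1 where "S1 \<subseteq> S" "finite S1" "solutions c n S1 = solutions c n S"
proof -
  let ?D = "solutions c n S0 - solutions c n S"
  have "\<exists>e\<in>S. p \<notin> solutions c n {e}" if "p \<in> ?D" for p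
    using that by (fastforce simp: solutions_iff)
  then obtain e where e: "\<And>p. p \<in> ?D \<Longrightarrow> e p \<in> S \<and> p \<notin> solutions c n {e p}"
    by metis
  let ?S1 = "S0 \<union> e ` ?D"
  have sub: "?S1 \<subseteq> S" using assms(1) e by blast
  have "p \<in> solutions c n S" if p: "p \<in> solutions c n ?S1" for p
  proof (rule ccontr)
    assume "p \<notin> solutions c n S"
    moreover have "p \<in> solutions c n S0"
      using p solutions_antimono[of S0 ?S1] by blast
    ultimately have D: "p \<in> ?D" by blast
    then have "p \<in> solutions c n {e p}"
      using p solutions_antimono[of "{e p}" ?S1] by blast
    with e[OF D] show False by blast
  qed
  then have "solutions c n ?S1 = solutions c n S"
    using solutions_antimono[OF sub] by blast
  moreover have "finite ?S1" using assms by simp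
  ultimately show thesis using that sub by blast
qed

text \<open>A finite subsystem with finitely many solutions could be enlarged to a finite one with
  exactly the solutions of \<open>S\<close>, so ruling out equality is enough.\<close>

lemma E_systemI:
  assumes "S \<subseteq> equations I n" "finite (solutions c n S)" "card (solutions c n S) = k"
    and "\<And>S'. S' \<subseteq> S \<Longrightarrow> finite S' \<Longrightarrow> solutions c n S' \<noteq> solutions c n S"
  shows "E_system I c k n S"
  unfolding E_system_def using assms solutions_finite_subsystem by metis

section \<open>Finite uniqueness from compactness, by doubling the variables\<close>

lemma q_omega_compact_finite_uniqueness:
  assumes comp: "q_omega_compact I c" and S: "S \<subseteq> equations I n"
    and uniq: "\<And>p q. p \<in> solutions c n S \<Longrightarrow> q \<in> solutions c n S \<Longrightarrow> p = q"
  obtains S' where "S' \<subseteq> S" "finite S'"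
    "\<And>p q. p \<in> solutions c n S' \<Longrightarrow> q \<in> solutions c n S' \<Longrightarrow> p = q"
proof -
  \<comment> \<open>The second copy y of the variables starts at index \<open>n\<close>;
    \<open>sh\<close> turns S(x) into S(y).\<close>
  define sh :: "('a, nat) bterm \<Rightarrow> ('a, nat) bterm" where "sh = map_bterm id ((+) n)"
  let ?r = "map_prod sh sh"
  let ?T = "S \<union> ?r ` S"
  have T: "?T \<subseteq> equations I (n + n)"
  proof -
    have "terms I n \<subseteq> terms I (n + n)" "sh ` terms I n \<subseteq> terms I (n + n)"
      by (auto simp: terms_def sh_def bterm.set_map subset_eq)
    then show ?thesis using S by (auto simp: equations_def)
  qed
  \<comment> \<open>Points of the doubled space have \<open>n + n\<close> coordinates, while
    solutions of \<open>S\<close> must be undefined from \<open>n\<close> on; this fact permits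
    truncating and extending points.\<close>
  have eq: "eval c p \<tau> = eval c p \<sigma> \<longleftrightarrow> eval c q \<tau> = eval c q \<sigma>"
    if "(\<tau>, \<sigma>) \<in> S" "\<And>i. i < n \<Longrightarrow> p i = q i" for p q \<tau> \<sigma>
  proof -
    have "eval c p \<tau> = eval c q \<tau>" "eval c p \<sigma> = eval c q \<sigma>"
      using that S by (auto simp: equations_def dest: terms_varsD intro!: eval_cong)
    then show ?thesis by simp
  qed
  have "\<exists>F \<subseteq> ?T. finite F \<and>
      solutions c (n + n) F \<subseteq> solutions c (n + n) {(Var i, Var (n + i))}" if i: "i < n" for i
  proof -
    have "solutions c (n + n) ?T \<subseteq> solutions c (n + n) {(Var i, Var (n + i))}"
    proof
      fix p assume p: "p \<in> solutions c (n + n) ?T"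
      have 1: "restrict p {..<n} \<in> solutions c n S"
        using p eq[of _ _ p "restrict p {..<n}"] by (auto simp: solutions_iff)
      have "eval c (\<lambda>j. p (n + j)) \<tau> = eval c (\<lambda>j. p (n + j)) \<sigma>" if "(\<tau>, \<sigma>) \<in> S" for \<tau> \<sigma>
      proof -
        have "(sh \<tau>, sh \<sigma>) \<in> ?T" using that by force
        then have "eval c p (sh \<tau>) = eval c p (sh \<sigma>)" by (rule solutionsD[OF p])
        then show ?thesis by (simp add: sh_def eval_map_bterm)
      qed
      then have 2: "(\<lambda>j\<in>{..<n}. p (n + j)) \<in> solutions c n S"
        using eq[of _ _ "\<lambda>j. p (n + j)" "\<lambda>j\<in>{..<n}. p (n + j)"] by (auto simp: solutions_iff)
      show "p \<in> solutions c (n + n) {(Var i, Var (n + i))}"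
        using p fun_cong[OF uniq[OF 1 2], of i] i by (simp add: solutions_iff)
    qed
    moreover have "(Var i, Var (n + i)) \<in> equations I (n + n)"
      using i by (auto simp: equations_def terms_def)
    ultimately show ?thesis
      using comp T unfolding q_omega_compact_def by blast
  qed
  then obtain F where F: "\<And>i. i < n \<Longrightarrow> F i \<subseteq> ?T" "\<And>i. i < n \<Longrightarrow> finite (F i)"
    "\<And>i. i < n \<Longrightarrow> solutions c (n + n) (F i) \<subseteq> solutions c (n + n) {(Var i, Var (n + i))}"
    by metis
  define G where "G = (\<Union>i<n. F i)"
  have G: "finite G" "G \<subseteq> ?T" "\<And>i. i < n \<Longrightarrow> F i \<subseteq> G"
    using F(1,2) by (auto simp only: G_def finite_UN finite_lessThan)
  then have "finite (G \<inter> ?r ` S)" by simp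
  \<comment> \<open>\<open>A\<close> consists of originals of the shifted equations in
    \<open>G\<close>. An equation may have been used in either copy, so \<open>?S'\<close> takes
    both kinds, and its two copies together cover \<open>G\<close>.\<close>
  then obtain A where A: "A \<subseteq> S" "finite A" "G \<inter> ?r ` S = ?r ` A"
    using finite_subset_image[of "G \<inter> ?r ` S" ?r S] by blast
  let ?S' = "(G \<inter> S) \<union> A"
  have "G = (G \<inter> S) \<union> ?r ` A" using G(2) by (simp only: flip: A(3)) blast
  also have "\<dots> \<subseteq> ?S' \<union> ?r ` ?S'" by (intro Un_mono image_mono Un_upper1 Un_upper2)
  finally have sub: "F i \<subseteq> ?S' \<union> ?r ` ?S'" if "i < n" for i
    using G(3)[OF that] by (rule order_trans[rotated])
  show thesis
  proof
    show "?S' \<subseteq> S" using A by blast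
    show "finite ?S'" using A G(1) by simp
    fix p q assume p: "p \<in> solutions c n ?S'" and q: "q \<in> solutions c n ?S'"
    \<comment> \<open>The concatenation of \<open>p\<close> and \<open>q\<close> solves both copies
      of \<open>?S'\<close>, hence every \<open>F i\<close>, which forces the coordinates to
      agree.\<close>
    let ?m = "\<lambda>i\<in>{..<n + n}. if i < n then p i else q (i - n)"
    have 1: "eval c ?m \<tau> = eval c ?m \<sigma>" if m: "(\<tau>, \<sigma>) \<in> ?S'" for \<tau> \<sigma>
    proof -
      have "(\<tau>, \<sigma>) \<in> S" using m A(1) by blast
      then show ?thesis using solutionsD[OF p m] by (subst eq[where q = p]) simp_all
    qed
    have 2: "eval c ?m (sh \<tau>) = eval c ?m (sh \<sigma>)" if m: "(\<tau>, \<sigma>) \<in> ?S'" for \<tau> \<sigma>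
    proof -
      have "(\<tau>, \<sigma>) \<in> S" using m A(1) by blast
      then show ?thesis unfolding sh_def eval_map_bterm
        using solutionsD[OF q m] by (subst eq[where q = q]) simp_all
    qed
    have m: "?m \<in> solutions c (n + n) (?S' \<union> ?r ` ?S')"
    proof (rule solutionsI)
      fix \<tau> \<sigma> assume "(\<tau>, \<sigma>) \<in> ?S' \<union> ?r ` ?S'"
      then show "eval c ?m \<tau> = eval c ?m \<sigma>" using 1 2 by blast
    qed simp
    have "p i = q i" if "i < n" for i
    proof -
      have "?m \<in> solutions c (n + n) {(Var i, Var (n + i))}"
        using m F(3)[OF that] solutions_antimono[OF sub[OF that]] by blast
      then show ?thesis using that by (simp add: solutions_iff)
    qed
    moreover have "p \<in> {..<n} \<rightarrow>\<^sub>E UNIV" "q \<in> {..<n} \<rightarrow>\<^sub>E UNIV"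
      using p q by (simp_all add: solutions_iff)
    ultimately show "p = q" by (intro PiE_ext) auto
  qed
qed

lemma q_omega_compact_imp_not_E_system:
  assumes "q_omega_compact I c" "k \<le> 1"
  shows "\<not> E_system I c k n S"
proof
  assume E: "E_system I c k n S"
  then have "finite (solutions c n S)" "card (solutions c n S) \<le> Suc 0"
    using assms(2) by (auto simp: E_system_def)
  then have "p = q" if "p \<in> solutions c n S" "q \<in> solutions c n S" for p q
    using that card_le_Suc0_iff_eq by blast
  then obtain S' where S': "S' \<subseteq> S" "finite S'"
    "\<And>p q. p \<in> solutions c n S' \<Longrightarrow> q \<in> solutions c n S' \<Longrightarrow> p = q"
    using q_omega_compact_finite_uniqueness[OF assms(1)] E unfolding E_system_def by metis
  have "finite (solutions c n S')"
  proof (rule ccontr)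
    assume inf: "infinite (solutions c n S')"
    then obtain p where "p \<in> solutions c n S'" by (metis finite.emptyI ex_in_conv)
    then have "solutions c n S' \<subseteq> {p}" using S'(3) by blast
    with inf show False using finite_subset by blast
  qed
  then show False using E S' by (auto simp: E_system_def)
qed

section \<open>Localization below a new variable\<close>

definition relativize :: "'v \<Rightarrow> ('i, 'v) bterm \<times> ('i, 'v) bterm \<Rightarrow> ('i, 'v) bterm \<times> ('i, 'v) bterm"
  where "relativize z = map_prod (And (Var z)) (And (Var z))"

text \<open>
  The first equation says that \<open>z\<close> lies below the symmetric difference of the two sides of \<open>e\<close>,
  the others that \<open>x\<^sub>i \<le> z\<close>; here \<open>z\<close> is \<open>x\<^sub>n\<close>.
\<close>
definition localizers :: "nat \<Rightarrow> 'i equation \<Rightarrow> 'i equation set" where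
  "localizers n e = insert (And (Var n) (fst e), And (Var n) (Neg (snd e)))
     ((\<lambda>i. (And (Var n) (Var i), Var i)) ` {..<n})"

definition localized :: "nat \<Rightarrow> 'i equation set \<Rightarrow> 'i equation \<Rightarrow> 'i equation set" where
  "localized n S e = relativize n ` S \<union> localizers n e"

lemma localized_subset_equations:
  assumes "S \<subseteq> equations I n" "e \<in> equations I n"
  shows "localized n S e \<subseteq> equations I (Suc n)"
proof -
  have "terms I n \<subseteq> terms I (Suc n)" by (auto simp: terms_def)
  then have "And (Var n) t \<in> terms I (Suc n)" if "t \<in> terms I n" for t
    using that by (auto simp: terms_def)
  moreover have "Neg t \<in> terms I n" if "t \<in> terms I n" for t
    using that by (simp add: terms_def)
  moreover have "Var i \<in> terms I n" if "i < n" for i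
    using that by (simp add: terms_def)
  ultimately show ?thesis
    using assms \<open>terms I n \<subseteq> terms I (Suc n)\<close>
    unfolding localized_def relativize_def localizers_def equations_def by auto
qed

lemma solutions_localized_iff:
  "p \<in> solutions c (Suc n) (localized n S (\<tau>, \<sigma>)) \<longleftrightarrow>
     p \<in> {..<Suc n} \<rightarrow>\<^sub>E UNIV \<and>
     (\<forall>(t, s) \<in> S. inf (p n) (eval c p t) = inf (p n) (eval c p s)) \<and>
     inf (p n) (eval c p \<tau>) = inf (p n) (- eval c p \<sigma>) \<and>
     (\<forall>i<n. inf (p n) (p i) = p i)"
  unfolding localized_def relativize_def localizers_def solutions_def
  by (simp add: ball_Un case_prod_unfold) blast

text \<open>At z = 0 both sides of every equation become 0, whether or not \<open>S\<close> is
  consistent.\<close>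

lemma origin_solves_localized:
  "(\<lambda>i\<in>{..<Suc n}. bot) \<in> solutions c (Suc n) (localized n S e)"
  by (cases e) (auto simp: solutions_localized_iff)

lemma solutions_localized_consistent:
  assumes S: "S \<subseteq> equations I n" and e: "e \<in> equations I n"
    and sub: "solutions c n S \<subseteq> solutions c n {e}" and a: "a \<in> solutions c n S"
  shows "solutions c (Suc n) (localized n S e) = {\<lambda>i\<in>{..<Suc n}. bot}"
proof -
  obtain \<tau> \<sigma> where [simp]: "e = (\<tau>, \<sigma>)" by (cases e)
  have "p = (\<lambda>i\<in>{..<Suc n}. bot)" if "p \<in> solutions c (Suc n) (localized n S e)" for p
  proof -
    define w where "w = p n"
    have p: "p \<in> {..<Suc n} \<rightarrow>\<^sub>E UNIV"
      "\<And>t s. (t, s) \<in> S \<Longrightarrow> inf w (eval c p t) = inf w (eval c p s)"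
      "inf w (eval c p \<tau>) = inf w (- eval c p \<sigma>)" "\<And>i. i < n \<Longrightarrow> inf w (p i) = p i"
      using that by (auto simp: solutions_localized_iff w_def)
    \<comment> \<open>\<open>g\<close> agrees with \<open>p\<close> below \<open>w\<close> and with
      the given solution \<open>a\<close> below \<open>- w\<close>, so the equations of
      \<open>S\<close> can be checked on the two parts separately.\<close>
    define g where "g = (\<lambda>i\<in>{..<n}. sup (inf w (p i)) (inf (- w) (a i)))"
    have "inf w (g i) = inf w (p i)" "inf (- w) (g i) = inf (- w) (a i)" if "i < n" for i
      using that by (simp_all add: g_def inf_sup_distrib1 flip: inf_assoc)
    then have g: "inf w (eval c g t) = inf w (eval c p t)"
      "inf (- w) (eval c g t) = inf (- w) (eval c a t)" if "t \<in> terms I n" for t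
      using that by (auto dest: terms_varsD intro!: inf_eval_cong)
    have "eval c g t = eval c g s" if "(t, s) \<in> S" for t s
    proof -
      have ts: "t \<in> terms I n" "s \<in> terms I n" using that S by (auto simp: equations_def)
      have 1: "inf w (eval c g t) = inf w (eval c g s)" using ts g p(2)[OF that] by simp
      have "eval c a t = eval c a s" using a that by (simp add: solutions_iff)
      then have 2: "inf (- w) (eval c g t) = inf (- w) (eval c g s)" using ts g by simp
      have "x = sup (inf w x) (inf (- w) x)" for x by (simp flip: inf_sup_distrib2)
      with 1 2 show ?thesis by metis
    qed
    then have "g \<in> solutions c n S" by (auto simp: solutions_iff g_def)
    then have "g \<in> solutions c n {e}" using sub by blast
    then have "eval c g \<tau> = eval c g \<sigma>" by (simp add: solutions_iff)
    then have "inf w (eval c p \<sigma>) = inf w (eval c p \<tau>)"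
      using e g by (metis \<open>e = (\<tau>, \<sigma>)\<close> equations_def mem_Sigma_iff)
    \<comment> \<open>Below \<open>w\<close>, the value of \<sigma> at \<open>p\<close> coincides
      with its own complement, which is possible only if \<open>w\<close> is
      \<open>bot\<close>.\<close>
    then have *: "inf w (eval c p \<sigma>) = inf w (- eval c p \<sigma>)" using p(3) by simp
    have "w = sup (inf w (eval c p \<sigma>)) (inf w (- eval c p \<sigma>))"
      by (simp flip: inf_sup_distrib1)
    also have "\<dots> = inf (inf w (eval c p \<sigma>)) (inf w (- eval c p \<sigma>))" using * by simp
    also have "\<dots> = bot" by (simp add: ac_simps)
    finally have w: "w = bot" .
    have "p i = bot" if "i < Suc n" for i
      using that w w_def p(4)[of i] by (auto simp: less_Suc_eq)
    then show ?thesis using p(1) by (intro PiE_ext[OF p(1)]) auto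
  qed
  then show ?thesis using origin_solves_localized by blast
qed

lemma solutions_localized_nonzero:
  assumes S: "S \<subseteq> equations I n" and e: "e \<in> equations I n"
    and q: "q \<in> solutions c n S" "q \<notin> solutions c n {e}"
  shows "\<exists>p \<in> solutions c (Suc n) (localized n S e). p \<noteq> (\<lambda>i\<in>{..<Suc n}. bot)"
proof -
  obtain \<tau> \<sigma> where e_eq: "e = (\<tau>, \<sigma>)" by (cases e)
  let ?t = "eval c q \<tau>" and ?s = "eval c q \<sigma>"
  \<comment> \<open>This is the largest z below the symmetric difference of the two sides at
    \<open>q\<close>. Cutting the coordinates of \<open>q\<close> down to \<open>w\<close> secures
    x_i \<le> z and leaves the values of terms below \<open>w\<close> unchanged.\<close>
  define w where "w = sup (inf ?t (- ?s)) (inf (- ?t) ?s)"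
  define p where "p = (\<lambda>i\<in>{..<Suc n}. if i = n then w else inf w (q i))"
  have pn: "p n = w" by (simp add: p_def)
  have ev: "inf w (eval c p t) = inf w (eval c q t)" if "t \<in> terms I n" for t
    using that by (intro inf_eval_cong) (auto dest!: terms_varsD simp: p_def)
  have "?t \<noteq> ?s" using q by (simp add: solutions_iff e_eq)
  have "w \<noteq> bot"
  proof
    assume "w = bot"
    then have "inf ?t (- ?s) = bot" "inf ?s (- ?t) = bot"
      by (auto simp: w_def sup_eq_bot_iff inf_commute)
    then have "?t \<le> ?s" "?s \<le> ?t" by (simp_all add: inf_shunt)
    with \<open>?t \<noteq> ?s\<close> show False by simp
  qed
  then have "p \<noteq> (\<lambda>i\<in>{..<Suc n}. bot)" using pn by (metis lessI lessThan_iff restrict_apply')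
  \<comment> \<open>Within the symmetric difference, \<tau> and the complement of \<sigma> both
    reduce to \<open>inf ?t (- ?s)\<close>.\<close>
  moreover have "inf w (eval c p \<tau>) = inf w (- eval c p \<sigma>)"
  proof -
    have "inf w (eval c p \<tau>) = inf w ?t" "inf w (- eval c p \<sigma>) = inf w (- ?s)"
      using e ev by (auto simp: e_eq equations_def intro: inf_uminus_cong)
    moreover have "inf w ?t = inf ?t (- ?s)"
    proof -
      have "inf (inf (- ?t) ?s) ?t = bot" by (simp add: inf_assoc)
      then show ?thesis by (simp add: w_def inf_sup_distrib2 inf_absorb1 le_infI1)
    qed
    moreover have "inf w (- ?s) = inf ?t (- ?s)"
      by (simp add: w_def inf_sup_distrib2 inf_assoc)
    ultimately show ?thesis by simp
  qed
  moreover have "inf w (eval c p t) = inf w (eval c p s)" if "(t, s) \<in> S" for t s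
    using that S q(1) ev[of t] ev[of s] by (auto simp: equations_def solutions_iff)
  moreover have "inf w (p i) = p i" if "i < n" for i using that by (simp add: p_def)
  moreover have "p \<in> {..<Suc n} \<rightarrow>\<^sub>E UNIV" by (auto simp: p_def)
  ultimately show ?thesis
    by (intro bexI[of _ p]) (auto simp: e_eq solutions_localized_iff pn)
qed

text \<open>The localizers belong to the localization of every subsystem, so only the finitely many
  relativized equations in \<open>T\<close> need originals in \<open>S\<close>.\<close>

lemma finite_subset_localized:
  assumes "T \<subseteq> localized n S e" "finite T"
  obtains S' where "S' \<subseteq> S" "finite S'" "T \<subseteq> localized n S' e"
proof -
  have "finite (T \<inter> relativize n ` S)" using assms(2) by simp
  then obtain S' where S': "S' \<subseteq> S" "finite S'" "T \<inter> relativize n ` S = relativize n ` S'"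
    using finite_subset_image[of "T \<inter> relativize n ` S" "relativize n" S] by blast
  moreover have "T \<subseteq> localized n S' e" using assms(1) S'(3) by (auto simp: localized_def)
  ultimately show thesis using that by blast
qed

section \<open>Failure of compactness yields an E_0- or E_1-system\<close>

lemma not_q_omega_compact_imp_E_system:
  assumes "\<not> q_omega_compact I c"
  shows "\<exists>n S k. k \<le> 1 \<and> E_system I c k n S"
proof -
  obtain n S e where S: "S \<subseteq> equations I n" and e: "e \<in> equations I n"
    and sub: "solutions c n S \<subseteq> solutions c n {e}"
    and no: "\<And>S'. S' \<subseteq> S \<Longrightarrow> finite S' \<Longrightarrow> \<not> solutions c n S' \<subseteq> solutions c n {e}"
    using assms unfolding q_omega_compact_def by metis
  show ?thesis
  proof (cases "solutions c n S = {}")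
    case True
    have "E_system I c 0 n S"
    proof (rule E_systemI)
      show "solutions c n S' \<noteq> solutions c n S" if "S' \<subseteq> S" "finite S'" for S'
        \<comment> \<open>A subsystem with the same solutions as \<open>S\<close> would entail
          \<open>e\<close> as well.\<close>
        using no[OF that] sub by auto
    qed (simp_all add: True S)
    then show ?thesis by (meson zero_le)
  next
    case False
    let ?T = "localized n S e"
    have V: "solutions c (Suc n) ?T = {\<lambda>i\<in>{..<Suc n}. bot}"
      using solutions_localized_consistent[OF S e sub] False by blast
    have "E_system I c 1 (Suc n) ?T"
    proof (rule E_systemI)
      show "?T \<subseteq> equations I (Suc n)" by (rule localized_subset_equations[OF S e])
      fix T assume "T \<subseteq> ?T" "finite T"
      then obtain S' where S': "S' \<subseteq> S" "finite S'" "T \<subseteq> localized n S' e"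
        by (rule finite_subset_localized)
      then obtain q where q: "q \<in> solutions c n S'" "q \<notin> solutions c n {e}" using no by blast
      have "\<exists>p \<in> solutions c (Suc n) (localized n S' e). p \<noteq> (\<lambda>i\<in>{..<Suc n}. bot)"
        using S S'(1) e q by (intro solutions_localized_nonzero) auto
      then show "solutions c (Suc n) T \<noteq> solutions c (Suc n) ?T"
        using V solutions_antimono[OF S'(3)] by blast
    qed (simp_all only: V, simp_all)
    then show ?thesis by blast
  qed
qed

theorem theorem6p3:
  fixes I :: "'i set" and c :: "'i \<Rightarrow> 'b::boolean_algebra"
  shows "q_omega_compact I c \<longleftrightarrow>
    \<not> (\<exists>n S. E_system I c 0 n S) \<and> \<not> (\<exists>n S. E_system I c 1 n S)"
proof
  assume "q_omega_compact I c"
  then show "\<not> (\<exists>n S. E_system I c 0 n S) \<and> \<not> (\<exists>n S. E_system I c 1 n S)"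
    using q_omega_compact_imp_not_E_system by (metis zero_le_one le_refl)
next
  assume E: "\<not> (\<exists>n S. E_system I c 0 n S) \<and> \<not> (\<exists>n S. E_system I c 1 n S)"
  have "k = 0 \<or> k = 1" if "k \<le> 1" for k :: nat using that by auto
  with E show "q_omega_compact I c" using not_q_omega_compact_imp_E_system by metis
qed

end
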